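(* Let $A\in\mathbb R^{m\times N}$ have unit columns, let $\mathcal S\subsetneq\{1,\dots,N\}$ be an index set, and let $M:=A_{\bullet\mathcal S}^TA_{\bullet\mathcal S}$. Then every nonzero vector $z\in\mathbb R^N_+$ with $\mathrm{supp}(z)=\mathcal S$ is recovered from $y=Az$ via constrained matching pursuit on $\mathcal P=\mathbb R^N_+$ if the following conditions hold: (i) $A_{\bullet\mathcal S}$ has full column rank, or equivalently $M$ is positive definite; and (ii) for any (possibly empty) index set $\mathcal J\subsetneq\mathcal S$, $$\big\|(M/M_{\mathcal J\mathcal J}\,x)_+\big\|_\infty>\big\|\big(A_{\bullet\mathcal S^c}^T[I-A_{\bullet\mathcal J}(A_{\bullet\mathcal J}^TA_{\bullet\mathcal J})^{-1}A_{\bullet\mathcal J}^T]A_{\bullet\mathcal S\setminus\mathcal J}\,x\big)_+\big\|_\infty,\qquad\forall\,x\in\mathbb R^{|\mathcal S\setminus\mathcal J|}_{++}.$$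
   Context: Unit columns: every column of $A$ has Euclidean norm $1$; $A_{\bullet\mathcal I}$ is the submatrix of columns indexed by $\mathcal I$. $(\cdot)_+=\max(\cdot,0)$, applied componentwise to vectors. $\mathbb R^n_+$ and $\mathbb R^n_{++}$ are the nonnegative and positive orthants. $\mathrm{supp}(x)=\{i:x_i\ne0\}$; $\mathcal S^c=\{1,\dots,N\}\setminus\mathcal S$; $\mathbf e_j$ is the $j$th standard basis vector; $I$ is the $m\times m$ identity. For $\mathcal J\subset\mathcal S$ and $\mathcal I=\mathcal S\setminus\mathcal J$, with rows and columns of $M$ indexed by $\mathcal S$, the Schur complement is $M/M_{\mathcal J\mathcal J}:=M_{\mathcal I\mathcal I}-M_{\mathcal I\mathcal J}M_{\mathcal J\mathcal J}^{-1}M_{\mathcal J\mathcal I}$; for $\mathcal J=\emptyset$ it is $M$ and the bracketed matrix is $I$. Constrained matching pursuit on $\mathcal P$ with input $y$: $x^0=0$, $\mathcal J_0=\emptyset$; for $k=0,1,\dots$: let $g^*_j=\min\{\|y-A(x^k+t\mathbf e_j)\|_2^2:t\in\mathbb R,\ x^k+t\mathbf e_j\in\mathcal P\}$ for each $j$; choose any $j^*_{k+1}$ minimizing $g^*_j$ over $j\in\{1,\dots,N\}$; set $\mathcal J_{k+1}=\mathcal J_k\cup\{j^*_{k+1}\}$; choose any $x^{k+1}$ minimizing $\|Aw-y\|_2^2$ over $w\in\mathcal P$ with $\mathrm{supp}(w)\subseteq\mathcal J_{k+1}$. Several sequences may be generated due to non-unique choices. "$z$ is recovered" (exact vector recovery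 of $z$) means: with $y=Az$, along every generated sequence there is an $s$ with $\mathcal J_s=\mathrm{supp}(z)$, and along every sequence, once $\mathcal J_s=\mathrm{supp}(z)$ is reached, the minimization problem defining $x^s$ has the unique solution $x^s=z$. *)

theory Defs
  imports "HOL-Analysis.Analysis"
begin

text \<open>
  The matrix A has rows indexed by \<open>'m\<close> and columns indexed by \<open>'n\<close>. Submatrices and subvectors
  keep these index types and are padded with zeros outside the selected index sets. Products,
  transposes, differences, ranks and maximum norms of positive parts of padded objects are the
  padded versions of (or, for numbers, equal to) those of the genuine smaller objects. Only
  inverses need a separate treatment, see \<open>block_inv\<close>.
\<close>

definition block :: "real^'n^'m \<Rightarrow> 'm set \<Rightarrow> 'n set \<Rightarrow> real^'n^'m" where
  "block A I J = (\<chi> i j. if i \<in> I \<and> j \<in> J then A $ i $ j else 0)"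

abbreviation cols :: "real^'n^'m \<Rightarrow> 'n set \<Rightarrow> real^'n^'m" where
  "cols A J \<equiv> block A UNIV J"

text \<open>
  The padded inverse of the submatrix of \<open>B\<close> with rows and columns in \<open>J\<close>; unspecified if that
  submatrix is singular, like \<^const>\<open>matrix_inv\<close>. For \<open>J = {}\<close> it is the zero matrix, so that the
  conventions for an empty \<open>J\<close> hold automatically.
\<close>

definition block_inv :: "'n set \<Rightarrow> real^'n^'n \<Rightarrow> real^'n^'n" where
  "block_inv J B = (SOME C. block C J J = C
     \<and> block B J J ** C = block (mat 1) J J \<and> C ** block B J J = block (mat 1) J J)"

definition schur_complement :: "'n set \<Rightarrow> 'n set \<Rightarrow> real^'n^'n \<Rightarrow> real^'n^'n" where
  "schur_complement S J M =
     block M (S - J) (S - J) - block M (S - J) J ** block_inv J (block M J J) ** block M J (S - J)"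

definition pos_part :: "real^'n \<Rightarrow> real^'n" where
  "pos_part v = (\<chi> i. max (v $ i) 0)"

definition supp :: "real^'n \<Rightarrow> 'n set" where
  "supp x = {i. x $ i \<noteq> 0}"

definition nonneg_orthant :: "(real^'n) set" where
  "nonneg_orthant = {x. \<forall>i. 0 \<le> x $ i}"

text \<open>The positive orthant of the vectors indexed by \<open>I\<close>, padded with zeros.\<close>

definition pos_orthant_on :: "'n set \<Rightarrow> (real^'n) set" where
  "pos_orthant_on I = {x. (\<forall>i\<in>I. 0 < x $ i) \<and> (\<forall>i. i \<notin> I \<longrightarrow> x $ i = 0)}"

text \<open>Constrained matching pursuit on \<open>P\<close> with input \<open>y\<close>.\<close>

definition gstar :: "real^'n^'m \<Rightarrow> real^'m \<Rightarrow> (real^'n) set \<Rightarrow> real^'n \<Rightarrow> 'n \<Rightarrow> real" where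
  "gstar A y P x j = (LEAST v. v \<in>
     {(norm (y - A *v (x + t *\<^sub>R axis j 1)))\<^sup>2 | t. x + t *\<^sub>R axis j 1 \<in> P})"

definition cmp_minimizer ::
    "real^'n^'m \<Rightarrow> real^'m \<Rightarrow> (real^'n) set \<Rightarrow> 'n set \<Rightarrow> real^'n \<Rightarrow> bool" where
  "cmp_minimizer A y P J w \<longleftrightarrow>
     is_arg_min (\<lambda>w. (norm (A *v w - y))\<^sup>2) (\<lambda>w. w \<in> P \<and> supp w \<subseteq> J) w"

text \<open>\<open>(x, J)\<close> is one of the possibly many sequences of iterates and index sets.\<close>

definition cmp_sequence ::
    "real^'n^'m \<Rightarrow> real^'m \<Rightarrow> (real^'n) set \<Rightarrow> (nat \<Rightarrow> real^'n) \<Rightarrow> (nat \<Rightarrow> 'n set) \<Rightarrow> bool" where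
  "cmp_sequence A y P x J \<longleftrightarrow>
     x 0 = 0 \<and> J 0 = {} \<and>
     (\<forall>k. (\<exists>j. is_arg_min (gstar A y P (x k)) (\<lambda>_. True) j \<and> J (Suc k) = J k \<union> {j})
          \<and> cmp_minimizer A y P (J (Suc k)) (x (Suc k)))"

definition recovered :: "real^'n^'m \<Rightarrow> (real^'n) set \<Rightarrow> real^'n \<Rightarrow> bool" where
  "recovered A P z \<longleftrightarrow>
     (\<forall>x J. cmp_sequence A (A *v z) P x J \<longrightarrow>
        (\<exists>s. J s = supp z) \<and>
        (\<forall>s. J s = supp z \<longrightarrow> {w. cmp_minimizer A (A *v z) P (J s) w} = {z} \<and> x s = z))"

end

theory Submission
  imports Defs
begin

text \<open>
  Let \<open>r = y - A x\<close> be the residual at an iterate \<open>x\<close> with support \<open>K\<close>. A step along \<open>e\<^sub>j\<close> lowers the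
  squared residual by exactly \<open>(c\<^sub>j)\<^sub>+\<^sup>2\<close>, where \<open>c = A\<^sup>T r\<close>, so the algorithm selects a maximizer of
  \<open>(c\<^sub>j)\<^sub>+\<close>. Optimality of \<open>x\<close> makes \<open>r\<close> orthogonal to the columns in \<open>K\<close>; hence \<open>r\<close> is the
  projection of \<open>A z'\<close> onto the complement of their span, where \<open>z'\<close> is the restriction of \<open>z\<close> to
  \<open>S - K\<close>. The two sides of the condition, taken for \<open>K\<close> instead of the possibly larger set of
  selected indices and at the vector \<open>z'\<close>, are then the maxima of \<open>(c\<^sub>j)\<^sub>+\<close> over \<open>S - K\<close> and over \<open>- S\<close>. Since
  \<open>c \<le> 0\<close> on the selected indices, every step adds a new index of \<open>S\<close>.
\<close>

section \<open>Padded submatrices, Gram matrices and their inverses\<close>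

lemma cols_mult_vec: "cols A I *v x = A *v (\<chi> i. if i \<in> I then x $ i else 0)"
  by (auto simp: vec_eq_iff matrix_vector_mult_def block_def intro!: sum.cong)

lemma block_one_mult_vec:
  fixes x :: "real^'n"
  shows "block (mat 1) J J *v x = (\<chi> i. if i \<in> J then x $ i else 0)"
proof -
  have "(block (mat 1) J J *v x) $ i
      = (\<Sum>j\<in>UNIV. if j = i then (if i \<in> J then x $ i else 0) else 0)" for i
    unfolding matrix_vector_mult_def vec_lambda_beta
    by (intro sum.cong) (auto simp: block_def mat_def)
  then show ?thesis
    by (simp add: vec_eq_iff)
qed

lemma cols_mult_block_one: "cols A J ** block (mat 1) J J = cols A J"
  by (rule matrix_eq[THEN iffD2])
    (simp add: cols_mult_vec block_one_mult_vec cong: if_cong flip: matrix_vector_mul_assoc)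

lemma transpose_cols_mult_vec:
  "(transpose (cols A I) *v r) $ i = (if i \<in> I then column i A \<bullet> r else 0)"
  by (auto simp: matrix_vector_mult_def transpose_def block_def column_def inner_vec_def)

lemma block_gram:
  assumes "I \<subseteq> S" "K \<subseteq> S"
  shows "block (transpose (cols A S) ** cols A S) I K = transpose (cols A I) ** cols A K"
  using assms
  by (auto simp: vec_eq_iff matrix_matrix_mult_def transpose_def block_def intro!: sum.cong)

text \<open>The row space of \<open>cols A S\<close> lies in the coordinate subspace of vectors
  vanishing outside \<open>S\<close>, and the rank hypothesis makes the dimensions equal. So
  \<open>x\<close> lies in both the row space and the null space, which meet only in zero.\<close>

lemma full_column_rank_kernel:
  fixes A :: "real^'n^'m"
  assumes "rank (cols A S) = card S" "A *v x = 0" "supp x \<subseteq> S"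
  shows "x = 0"
proof -
  let ?L = "{x::real^'n. \<forall>i. i \<notin> S \<longrightarrow> x $ i = 0}"
  have "span (rows (cols A S)) = ?L"
  proof (rule subspace_dim_equal)
    show "span (rows (cols A S)) \<subseteq> ?L"
      by (rule span_minimal) (auto simp: rows_def row_def block_def subspace_def)
    show "dim ?L \<le> dim (span (rows (cols A S)))"
      using assms(1) dim_substandard_cart[of S, where 'a = real]
      by (simp add: row_rank_def dim_vec_eq)
  qed (auto simp: subspace_def span_zero span_add span_scale)
  moreover have "x \<in> ?L"
    using assms(3) by (auto simp: supp_def)
  moreover have "(\<chi> i. if i \<in> S then x $ i else 0) = x"
    using assms(3) by (auto simp: vec_eq_iff supp_def)
  then have "cols A S *v x = 0"
    using assms(2) by (simp add: cols_mult_vec)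
  ultimately show ?thesis
    using nullspace_inter_rowspace[of "cols A S" x] by blast
qed

text \<open>Since \<open>block_inv\<close> is a choice, it suffices to exhibit one padded inverse;
  the equation then holds for whichever one is chosen. The witness is \<open>E ** D\<close>, where
  \<open>E\<close> projects onto the coordinates in \<open>J\<close> and \<open>D\<close> inverts
  \<open>H\<close>.\<close>

lemma block_inv_gram:
  fixes A :: "real^'n^'m"
  assumes inj: "\<And>x. A *v x = 0 \<Longrightarrow> supp x \<subseteq> J \<Longrightarrow> x = 0"
  shows "block_inv J (transpose (cols A J) ** cols A J) ** (transpose (cols A J) ** cols A J)
    = block (mat 1) J J"
proof -
  txt \<open>\<open>H\<close> extends the Gram matrix by an identity block outside \<open>J\<close>, so it is invertible as a full matrix.\<close>
  define G where "G = transpose (cols A J) ** cols A J"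
  define E where "E = (block (mat 1) J J :: real^'n^'n)"
  define H where "H = G + (mat 1 - E)"
  have Ev: "(E *v x) $ i = (if i \<in> J then x $ i else 0)" for x i
    by (simp add: E_def block_one_mult_vec)
  have EE: "E ** E = E"
    by (rule matrix_eq[THEN iffD2]) (simp add: vec_eq_iff Ev flip: matrix_vector_mul_assoc)
  have GE: "G ** E = G"
    by (simp add: G_def E_def cols_mult_block_one flip: matrix_mul_assoc)
  have "E ** transpose (cols A J) = transpose (cols A J)"
    by (rule matrix_eq[THEN iffD2])
      (simp add: vec_eq_iff Ev transpose_cols_mult_vec del: transpose_matrix_vector
        flip: matrix_vector_mul_assoc)
  then have EG: "E ** G = G"
    by (simp add: G_def matrix_mul_assoc)
  have EH: "E ** H = G" and HE: "H ** E = G"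
    unfolding matrix_eq H_def
    by (simp_all only: matrix_vector_mul_assoc[symmetric] matrix_vector_mult_add_rdistrib
        matrix_vector_mult_diff_rdistrib matrix_vector_right_distrib matrix_vector_mult_diff_distrib)
      (simp_all add: matrix_vector_mul_assoc EG GE EE)
  have "x = 0" if "H *v x = 0" for x
  proof -
    \<comment> \<open>The part of \<open>H *v x\<close> inside \<open>J\<close> is
      \<open>G *v x\<close> and the part outside is \<open>x - E *v x\<close>, so both vanish. The
      second puts the support of \<open>x\<close> in \<open>J\<close>, and the first gives
      \<open>A *v x = 0\<close> through the quadratic form of \<open>G\<close>.\<close>
    have "G *v x = E *v (H *v x)"
      by (simp add: matrix_vector_mul_assoc EH)
    then have Gx: "G *v x = 0"
      using that by simp
    then have "x - E *v x = 0"
      using that by (simp add: H_def matrix_vector_mult_add_rdistrib matrix_vector_mult_diff_rdistrib)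
    then have x: "E *v x = x"
      by simp
    have "(cols A J *v x) \<bullet> (cols A J *v x) = x \<bullet> (G *v x)"
      by (simp add: G_def dot_lmul_matrix inner_commute[of x] flip: matrix_vector_mul_assoc)
    then have "cols A J *v x = 0"
      using Gx by simp
    moreover have "(\<chi> i. if i \<in> J then x $ i else 0) = x"
      using x by (simp add: E_def block_one_mult_vec)
    ultimately have "A *v x = 0"
      by (simp add: cols_mult_vec)
    moreover have "supp x \<subseteq> J"
      using Ev[of x] unfolding x supp_def by (force split: if_splits)
    ultimately show "x = 0"
      by (rule inj)
  qed
  then obtain D where DH: "D ** H = mat 1"
    using matrix_left_invertible_ker by blast
  then have HD: "H ** D = mat 1"
    by (simp add: matrix_left_right_inverse)
  \<comment> \<open>\<open>E\<close> commutes with \<open>H\<close>, hence with its inverse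
    \<open>D\<close>. This makes \<open>E ** D\<close> invariant under restriction to
    \<open>J\<close> and an inverse of \<open>G\<close> on both sides.\<close>
  have "E ** D = D ** (H ** E) ** D"
    by (simp add: matrix_mul_assoc DH)
  also have "\<dots> = D ** E ** (H ** D)"
    by (simp add: HE flip: EH) (simp add: matrix_mul_assoc)
  finally have ED: "E ** D = D ** E"
    by (simp add: HD)
  have block_eq: "block B J J = E ** B ** E" for B
  proof -
    have "(block B J J *v x) $ i = (E *v (B *v (E *v x))) $ i" for x i
      unfolding matrix_vector_mult_def[of B] matrix_vector_mult_def[of "block B J J"] Ev vec_lambda_beta
      by (auto simp: block_def intro!: sum.cong)
    then show ?thesis
      unfolding matrix_eq vec_eq_iff by (simp add: matrix_vector_mul_assoc matrix_mul_assoc)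
  qed
  have "block (E ** D) J J = (E ** E) ** (D ** E)"
    by (simp add: block_eq matrix_mul_assoc)
  then have "block (E ** D) J J = E ** D"
    by (simp add: EE matrix_mul_assoc flip: ED)
  moreover have "block G J J = G"
    by (simp add: block_eq EG GE)
  moreover have "G ** (E ** D) = E ** (H ** D)"
    by (simp add: matrix_mul_assoc GE EH)
  then have "G ** (E ** D) = E"
    by (simp add: HD)
  moreover have "E ** D ** G = D ** (E ** G)"
    by (simp add: ED matrix_mul_assoc)
  then have "E ** D ** G = D ** H ** E"
    by (simp add: EG HE flip: matrix_mul_assoc)
  then have "E ** D ** G = E"
    by (simp add: DH)
  ultimately have "\<exists>C. block C J J = C \<and> block G J J ** C = E \<and> C ** block G J J = E"
    by metis
  then have "block_inv J G ** block G J J = E"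
    unfolding block_inv_def E_def by (rule someI2_ex) blast
  then show ?thesis
    unfolding \<open>block G J J = G\<close> by (simp only: G_def E_def)
qed

lemma infnorm_pos_part_less:
  assumes "infnorm (pos_part v) < infnorm (pos_part w)"
  obtains i where "\<And>j. max (v $ j) 0 < max (w $ i) 0"
proof -
  have "infnorm (pos_part w) \<in> (\<lambda>i. \<bar>pos_part w \<bullet> i\<bar>) ` Basis"
    unfolding infnorm_Max by (rule Max_in) auto
  then obtain i where i: "infnorm (pos_part w) = \<bar>pos_part w $ i\<bar>"
    by (auto simp: Basis_vec_def inner_axis)
  have "max (v $ j) 0 < max (w $ i) 0" for j
    using component_le_infnorm_cart[of "pos_part v" j] assms i by (simp add: pos_part_def)
  then show thesis ..
qed

section \<open>One-coordinate steps in the nonnegative orthant\<close>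

context
  fixes A :: "real^'n^'m"
  assumes unit: "\<And>j. norm (column j A) = 1"
begin

lemma residual_step:
  "(norm (y - A *v (x + t *\<^sub>R axis j 1)))\<^sup>2
    = (norm (y - A *v x))\<^sup>2 - 2 * t * (column j A \<bullet> (y - A *v x)) + t\<^sup>2"
proof -
  have "column j A \<bullet> column j A = 1"
    using unit[of j] by (simp add: norm_eq_1)
  moreover have "y - A *v (x + t *\<^sub>R axis j 1) = (y - A *v x) - t *\<^sub>R column j A"
    by (simp only: matrix_vector_right_distrib matrix_vector_mult_scaleR matrix_vector_mult_basis
        diff_diff_eq)
  moreover have "(norm (r - t *\<^sub>R a))\<^sup>2 = (norm r)\<^sup>2 - 2 * t * (a \<bullet> r) + t\<^sup>2 * (a \<bullet> a)" for r a :: "real^'m"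
    unfolding power2_norm_eq_inner
    by (simp add: inner_diff_left inner_diff_right inner_commute power2_eq_square)
  ultimately show ?thesis
    by (metis mult.right_neutral)
qed

text \<open>Unit columns make the objective along a coordinate equal to \<open>(s - c j)^2\<close>
  up to a constant. The feasible steps form a half-line starting at \<open>- x $ j\<close>, and its
  point nearest to \<open>c j\<close> is \<open>t j\<close>.\<close>

lemma gstar_nonneg_orthant:
  fixes x :: "real^'n" and y :: "real^'m"
  assumes "x \<in> nonneg_orthant"
  defines "c \<equiv> \<lambda>j. column j A \<bullet> (y - A *v x)"
  defines "t \<equiv> \<lambda>j. max (c j) (- x $ j)"
  shows "gstar A y nonneg_orthant x j = (norm (y - A *v x))\<^sup>2 - 2 * t j * c j + (t j)\<^sup>2"
proof -
  have feasible: "x + s *\<^sub>R axis j 1 \<in> nonneg_orthant \<longleftrightarrow> - x $ j \<le> s" for s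
    using assms(1) by (force simp: nonneg_orthant_def axis_def)
  have "(t j)\<^sup>2 - 2 * t j * c j \<le> s\<^sup>2 - 2 * s * c j" if "- x $ j \<le> s" for s
  proof -
    have "\<bar>t j - c j\<bar> \<le> \<bar>s - c j\<bar>"
      using that by (auto simp: t_def)
    then have "(t j - c j)\<^sup>2 \<le> (s - c j)\<^sup>2"
      by (rule abs_le_square_iff[THEN iffD1])
    then show ?thesis
      by (simp add: power2_diff algebra_simps)
  qed
  note best = this
  show ?thesis
    unfolding gstar_def
  proof (rule Least_equality)
    show "(norm (y - A *v x))\<^sup>2 - 2 * t j * c j + (t j)\<^sup>2
      \<in> {(norm (y - A *v (x + t *\<^sub>R axis j 1)))\<^sup>2 | t. x + t *\<^sub>R axis j 1 \<in> nonneg_orthant}"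
      unfolding residual_step feasible by (auto simp: t_def c_def)
  next
    fix v
    assume "v \<in> {(norm (y - A *v (x + t *\<^sub>R axis j 1)))\<^sup>2 | t. x + t *\<^sub>R axis j 1 \<in> nonneg_orthant}"
    then show "(norm (y - A *v x))\<^sup>2 - 2 * t j * c j + (t j)\<^sup>2 \<le> v"
      unfolding residual_step feasible using best by (force simp: c_def)
  qed
qed

text \<open>The best feasible step along an index of \<open>J\<close> stays within the constraints,
  so at a minimizer it must be zero. The single equation encodes nonnegativity of
  \<open>x $ j\<close>, nonpositivity of the correlation, and complementary slackness.\<close>

lemma cmp_minimizer_KKT:
  assumes "cmp_minimizer A y nonneg_orthant J x" "j \<in> J"
  shows "max (column j A \<bullet> (y - A *v x)) (- x $ j) = 0"
proof -
  define c where "c = column j A \<bullet> (y - A *v x)"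
  define t where "t = max c (- x $ j)"
  define w where "w = x + t *\<^sub>R axis j 1"
  have x: "x \<in> nonneg_orthant" "supp x \<subseteq> J"
    and min: "\<And>w. w \<in> nonneg_orthant \<Longrightarrow> supp w \<subseteq> J \<Longrightarrow> (norm (y - A *v x))\<^sup>2 \<le> (norm (y - A *v w))\<^sup>2"
    using assms(1) by (auto simp: cmp_minimizer_def is_arg_min_def norm_minus_commute not_less)
  have "w \<in> nonneg_orthant"
    using x(1) by (auto simp: w_def nonneg_orthant_def axis_def t_def)
  moreover have "supp w \<subseteq> J"
    using x(2) assms(2) by (auto simp: w_def supp_def axis_def split: if_splits)
  ultimately have "(norm (y - A *v x))\<^sup>2 \<le> (norm (y - A *v w))\<^sup>2"
    by (rule min)
  then have le: "2 * t * c \<le> t * t"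
    unfolding w_def residual_step c_def[symmetric] by (simp add: power2_eq_square)
  have "x $ j \<ge> 0"
    using x(1) by (simp add: nonneg_orthant_def)
  have "t = 0"
  proof (cases "c > 0")
    case True
    with \<open>x $ j \<ge> 0\<close> have "t = c"
      by (simp add: t_def)
    with le True show ?thesis
      by simp
  next
    case False
    show ?thesis
    proof (rule ccontr)
      assume "t \<noteq> 0"
      \<comment> \<open>Here \<open>c <= t < 0\<close>, whence
        \<open>2 * c <= 2 * t < t\<close>.\<close>
      with False \<open>x $ j \<ge> 0\<close> have "t < 0" "2 * c < t"
        by (auto simp: t_def max_def split: if_splits)
      then have "t * t < t * (2 * c)"
        by (simp add: mult_less_cancel_left_neg)
      with le show False
        by simp
    qed
  qed
  then show ?thesis
    by (simp add: t_def c_def)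
qed

text \<open>
  The bound \<open>- x $ j\<close> on the step disappears: \<open>x $ j = 0\<close> for indices outside \<open>J\<close>, and along those
  in \<open>J\<close> the optimal step is zero.
\<close>

lemma gstar_cmp_minimizer:
  assumes "cmp_minimizer A y nonneg_orthant J x"
  shows "gstar A y nonneg_orthant x j
    = (norm (y - A *v x))\<^sup>2 - (max (column j A \<bullet> (y - A *v x)) 0)\<^sup>2"
proof -
  have x: "x \<in> nonneg_orthant" "supp x \<subseteq> J"
    using assms by (auto simp: cmp_minimizer_def is_arg_min_def)
  show ?thesis
  proof (cases "j \<in> J")
    case True
    with cmp_minimizer_KKT[OF assms True] show ?thesis
      by (simp add: gstar_nonneg_orthant[OF x(1)] max_def split: if_splits)
  next
    case False
    then have "x $ j = 0"
      using x(2) by (auto simp: supp_def)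
    then show ?thesis
      by (simp add: gstar_nonneg_orthant[OF x(1)] max_def power2_eq_square)
  qed
qed

end

section \<open>Residuals as projections and the selected index\<close>

text \<open>Orthogonality turns into normal equations for \<open>z - x\<close> on \<open>J\<close>,
  which the padded inverse solves. The right-hand side no longer contains \<open>x\<close>, which
  brings the residual into the form occurring in the condition.\<close>

lemma residual_projection:
  fixes A :: "real^'n^'m"
  assumes inj: "\<And>x. A *v x = 0 \<Longrightarrow> supp x \<subseteq> J \<Longrightarrow> x = 0"
    and "J \<subseteq> S" "supp z \<subseteq> S" "supp x \<subseteq> J"
    and orth: "\<And>j. j \<in> J \<Longrightarrow> column j A \<bullet> (A *v z - A *v x) = 0"
  defines "C \<equiv> block_inv J (transpose (cols A J) ** cols A J)"
  shows "A *v z - A *v x = cols A (S - J) *v z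
    - cols A J *v (C *v (transpose (cols A J) *v (cols A (S - J) *v z)))"
proof -
  define v where "v = cols A (S - J) *v z"
  have split: "A *v z - A *v x = v + cols A J *v (z - x)"
  proof -
    have "z - x = (\<chi> i. if i \<in> S - J then z $ i else 0) + (\<chi> i. if i \<in> J then (z - x) $ i else 0)"
      using assms(2-4) by (auto simp: vec_eq_iff supp_def subset_iff; metis)
    then have "A *v (z - x) = v + cols A J *v (z - x)"
      unfolding v_def cols_mult_vec matrix_vector_right_distrib[symmetric] by (rule arg_cong)
    then show ?thesis
      by (simp add: matrix_vector_mult_diff_distrib)
  qed
  have "transpose (cols A J) *v (A *v z - A *v x) = 0"
    using orth by (simp add: vec_eq_iff transpose_cols_mult_vec del: transpose_matrix_vector)
  then have "(transpose (cols A J) ** cols A J) *v (z - x) = - (transpose (cols A J) *v v)"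
    unfolding split by (simp add: matrix_vector_right_distrib matrix_vector_mul_assoc
        add_eq_0_iff)
  then have "C *v ((transpose (cols A J) ** cols A J) *v (z - x)) = - (C *v (transpose (cols A J) *v v))"
    using matrix_vector_mult_diff_distrib[of C 0 "transpose (cols A J) *v v"] by simp
  moreover have "C ** (transpose (cols A J) ** cols A J) = block (mat 1) J J"
    unfolding C_def by (rule block_inv_gram) (rule inj)
  ultimately have "block (mat 1) J J *v (z - x) = - (C *v (transpose (cols A J) *v v))"
    by (simp only: matrix_vector_mul_assoc)
  moreover have "cols A J *v (block (mat 1) J J *v (z - x)) = cols A J *v (z - x)"
    by (simp add: matrix_vector_mul_assoc cols_mult_block_one)
  ultimately have "cols A J *v (z - x) = cols A J *v (- (C *v (transpose (cols A J) *v v)))"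
    by simp
  also have "\<dots> = - (cols A J *v (C *v (transpose (cols A J) *v v)))"
    using matrix_vector_mult_diff_distrib[of "cols A J" 0 "C *v (transpose (cols A J) *v v)"] by simp
  finally show ?thesis
    using split by (simp add: v_def)
qed

lemma cmp_selects_support_index:
  fixes A :: "real^'n^'m" and S :: "'n set" and M :: "real^'n^'n"
  assumes unit: "\<And>j. norm (column j A) = 1"
    and M: "M = transpose (cols A S) ** cols A S"
    and inj: "\<And>x. A *v x = 0 \<Longrightarrow> supp x \<subseteq> S \<Longrightarrow> x = 0"
    and condition: "\<And>J x. J \<subset> S \<Longrightarrow> x \<in> pos_orthant_on (S - J) \<Longrightarrow>
      infnorm (pos_part (schur_complement S J M *v x))
      > infnorm (pos_part ((transpose (cols A (- S))
          ** (mat 1 - cols A J ** block_inv J (transpose (cols A J) ** cols A J)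
                       ** transpose (cols A J))
          ** cols A (S - J)) *v x))"
    and z: "z \<in> nonneg_orthant" "supp z = S"
    and J: "J \<subset> S"
    and x: "cmp_minimizer A (A *v z) nonneg_orthant J x"
    and j: "is_arg_min (gstar A (A *v z) nonneg_orthant x) (\<lambda>_. True) j"
  shows "j \<in> S - J"
proof -
  \<comment> \<open>Complementary slackness gives orthogonality only where \<open>x\<close> is
    positive. On \<open>J - K\<close> merely \<open>c i <= 0\<close> is known, so the projection
    formula cannot be used for \<open>J\<close> itself.\<close>
  define K where "K = supp x"
  define r where "r = A *v z - A *v x"
  define c where "c = (\<lambda>j. column j A \<bullet> r)"
  define C where "C = block_inv K (transpose (cols A K) ** cols A K)"
  define u where "u = (\<chi> i. if i \<in> S - K then z $ i else 0)"
  have xJ: "K \<subseteq> J" and x0: "x \<in> nonneg_orthant"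
    using x by (auto simp: K_def cmp_minimizer_def is_arg_min_def)
  have K: "K \<subset> S"
    using xJ J by blast
  have orth: "c i = 0" if "i \<in> K" for i
  proof -
    have "x $ i > 0"
      using that x0 by (auto simp: K_def supp_def nonneg_orthant_def order_less_le)
    then show ?thesis
      using cmp_minimizer_KKT[OF unit x, of i] that xJ by (auto simp: c_def r_def max_def split: if_splits)
  qed
  have neg: "c i \<le> 0" if "i \<in> J" for i
    using cmp_minimizer_KKT[OF unit x that] by (simp add: c_def r_def max_def split: if_splits)
  have "r = cols A (S - K) *v z - cols A K *v (C *v (transpose (cols A K) *v (cols A (S - K) *v z)))"
    unfolding r_def C_def
  proof (rule residual_projection)
    show "v = 0" if "A *v v = 0" "supp v \<subseteq> K" for v
      using that K inj by blast
  qed (use K z orth in \<open>auto simp: K_def c_def r_def\<close>)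
  moreover have "cols A (S - K) *v z = cols A (S - K) *v u"
    unfolding cols_mult_vec u_def by (rule arg_cong[of _ _ "(*v) A"]) (simp add: vec_eq_iff)
  ultimately have r: "r = cols A (S - K) *v u
      - cols A K *v (C *v (transpose (cols A K) *v (cols A (S - K) *v u)))"
    by simp
  have "u \<in> pos_orthant_on (S - K)"
    using z by (auto simp: u_def pos_orthant_on_def supp_def nonneg_orthant_def order_less_le)
  note less = condition[OF K this]
  \<comment> \<open>The Schur complement of a Gram matrix is the Gram matrix of the projected
    columns, so applying it to \<open>u\<close> gives the correlations of the columns in
    \<open>S - K\<close> with \<open>r\<close>.\<close>
  have "schur_complement S K M *v u = transpose (cols A (S - K)) *v r"
    using K by (simp add: schur_complement_def M block_gram r C_def matrix_vector_mult_diff_rdistrib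
        matrix_vector_mult_diff_distrib flip: matrix_vector_mul_assoc)
  moreover have "(transpose (cols A (- S)) ** (mat 1 - cols A K ** C ** transpose (cols A K))
          ** cols A (S - K)) *v u = transpose (cols A (- S)) *v r"
    by (simp add: r matrix_vector_mult_diff_rdistrib
        matrix_vector_mult_diff_distrib flip: matrix_vector_mul_assoc)
  ultimately obtain i where i: "\<And>j. max ((transpose (cols A (- S)) *v r) $ j) 0
      < max ((transpose (cols A (S - K)) *v r) $ i) 0"
    using infnorm_pos_part_less[OF less] unfolding C_def by auto
  \<comment> \<open>The index \<open>i\<close> lies in \<open>S - K\<close>: elsewhere the padded
    entry is zero, which cannot strictly exceed a positive part.\<close>
  have other: "max (c l) 0 < max (c i) 0" if "l \<notin> S" for l
    using i[of l] that by (auto simp: transpose_cols_mult_vec c_def less_max_iff_disj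
        simp del: transpose_matrix_vector split: if_splits)
  have pos: "0 < max (c i) 0"
    using i[of i] by (auto simp: transpose_cols_mult_vec c_def simp del: transpose_matrix_vector split: if_splits)
  have "gstar A (A *v z) nonneg_orthant x j \<le> gstar A (A *v z) nonneg_orthant x i"
    using j by (simp add: is_arg_min_def not_less)
  then have "(max (c i) 0)\<^sup>2 \<le> (max (c j) 0)\<^sup>2"
    by (simp add: gstar_cmp_minimizer[OF unit x] c_def r_def)
  then have "max (c i) 0 \<le> max (c j) 0"
    by (rule power2_le_imp_le) simp
  \<comment> \<open>An index outside \<open>S\<close> would contradict \<open>other\<close>; one in
    \<open>J\<close> has \<open>c j <= 0\<close>, against \<open>pos\<close>.\<close>
  then show ?thesis
    using other[of j] neg[of j] pos by fastforce
qed

text \<open>The feasible vector \<open>z\<close> has residual zero, so every minimizer does too and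
  differs from \<open>z\<close> by a kernel vector supported in \<open>S\<close>.\<close>

lemma cmp_minimizer_support:
  fixes A :: "real^'n^'m"
  assumes inj: "\<And>x. A *v x = 0 \<Longrightarrow> supp x \<subseteq> S \<Longrightarrow> x = 0"
    and z: "z \<in> nonneg_orthant" "supp z = S"
  shows "cmp_minimizer A (A *v z) nonneg_orthant S w \<longleftrightarrow> w = z"
proof
  assume w: "cmp_minimizer A (A *v z) nonneg_orthant S w"
  then have "\<not> (norm (A *v z - A *v z))\<^sup>2 < (norm (A *v w - A *v z))\<^sup>2"
    using z unfolding cmp_minimizer_def is_arg_min_def by blast
  then have "A *v (w - z) = 0"
    by (simp add: matrix_vector_mult_diff_distrib)
  moreover have "supp (w - z) \<subseteq> S"
    using w z by (auto simp: cmp_minimizer_def is_arg_min_def supp_def)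
  ultimately show "w = z"
    using inj[of "w - z"] by simp
qed (use z in \<open>simp add: cmp_minimizer_def is_arg_min_def\<close>)

theorem theorem5p5:
  fixes A :: "real^'n^'m" and S :: "'n set" and M :: "real^'n^'n"
  assumes unit_columns: "\<And>j. norm (column j A) = 1"
    and proper: "S \<subset> UNIV"
    and M: "M = transpose (cols A S) ** cols A S"
    and full_column_rank: "rank (cols A S) = card S"
    and condition: "\<And>J x. J \<subset> S \<Longrightarrow> x \<in> pos_orthant_on (S - J) \<Longrightarrow>
      infnorm (pos_part (schur_complement S J M *v x))
      > infnorm (pos_part ((transpose (cols A (- S))
          ** (mat 1 - cols A J ** block_inv J (transpose (cols A J) ** cols A J)
                       ** transpose (cols A J))
          ** cols A (S - J)) *v x))"
  shows "\<forall>z \<in> nonneg_orthant. z \<noteq> 0 \<longrightarrow> supp z = S \<longrightarrow> recovered A nonneg_orthant z"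
proof (intro ballI impI)
  fix z :: "real^'n"
  assume z: "z \<in> nonneg_orthant" "z \<noteq> 0" "supp z = S"
  note inj = full_column_rank_kernel[OF full_column_rank]
  show "recovered A nonneg_orthant z"
    unfolding recovered_def
  proof (intro allI impI conjI)
    fix x J
    assume "cmp_sequence A (A *v z) nonneg_orthant x J"
    then have start: "x 0 = 0" "J 0 = {}"
      and step: "\<And>k. \<exists>j. is_arg_min (gstar A (A *v z) nonneg_orthant (x k)) (\<lambda>_. True) j
        \<and> J (Suc k) = J k \<union> {j}"
      and min_Suc: "\<And>k. cmp_minimizer A (A *v z) nonneg_orthant (J (Suc k)) (x (Suc k))"
      by (auto simp: cmp_sequence_def)
    \<comment> \<open>Zero is the only vector with empty support, so the initial iterate is a
      minimizer as well and the first step needs no separate treatment.\<close>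
    have "supp w \<subseteq> {} \<longleftrightarrow> w = 0" for w :: "real^'n"
      by (auto simp: supp_def vec_eq_iff)
    then have "cmp_minimizer A (A *v z) nonneg_orthant (J 0) (x 0)"
      unfolding start cmp_minimizer_def is_arg_min_def by (simp add: nonneg_orthant_def)
    then have min: "cmp_minimizer A (A *v z) nonneg_orthant (J k) (x k)" for k
      using min_Suc by (cases k) auto
    \<comment> \<open>Each of the first \<open>card S\<close> steps adds a fresh index of
      \<open>S\<close>; counting then forces \<open>J (card S) = S\<close>.\<close>
    have "J k \<subseteq> S \<and> card (J k) = k" if "k \<le> card S" for k
      using that
    proof (induction k)
      case 0
      then show ?case
        by (simp add: start)
    next
      case (Suc k)
      then have "J k \<subset> S" "card (J k) = k"
        by auto
      moreover obtain j where j: "is_arg_min (gstar A (A *v z) nonneg_orthant (x k)) (\<lambda>_. True) j"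
        and "J (Suc k) = J k \<union> {j}"
        using step by blast
      moreover have "j \<in> S - J k"
        by (rule cmp_selects_support_index[OF unit_columns M inj condition z(1,3) \<open>J k \<subset> S\<close> min j])
      ultimately show ?case
        by auto
    qed
    then have "J (card S) = S"
      using card_subset_eq[of S] by auto
    then show "\<exists>s. J s = supp z"
      using z(3) by blast
    fix s
    assume "J s = supp z"
    then have "J s = S"
      using z(3) by simp
    then show "{w. cmp_minimizer A (A *v z) nonneg_orthant (J s) w} = {z}" "x s = z"
      using cmp_minimizer_support[OF inj z(1,3)] min[of s] by auto
  qed
qed

end
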